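(* Let $G$ be a Hoffman colorable graph with chromatic number $\chi=\chi(G)$ and with Hoffman coloring $V(G)=\bigsqcup_{i=1}^{\chi} V_i$ (color classes $V_1,\dots,V_\chi$), and let $x$ be a positive eigenvector of $G$. Let $C\subseteq\{1,\dots,\chi\}$ with $|C|\ge 2$, and let $H$ be the induced subgraph of $G$ on the vertex set $\bigcup_{i\in C}V_i$. Then the following hold. (i) $H$ is Hoffman colorable, with Hoffman coloring $V(H)=\bigsqcup_{i\in C}V_i$. (ii) $\lambda_{\max}(H)=\frac{|C|-1}{\chi-1}\lambda_{\max}(G)$. (iii) The restriction of $x$ to $V(H)$ is a positive eigenvector of $H$, and consequently its eigenvalue is $\lambda_{\max}(H)$. (iv) $\lambda_{\min}(H)=\lambda_{\min}(G)$.
   Context: All graphs are finite, simple and undirected. $\lambda_{\max}(G)$ and $\lambda_{\min}(G)$ denote the largest and smallest eigenvalues of the adjacency matrix of $G$; $\chi(G)$ is the chromatic number. An eigenvector of $G$ means an eigenvector of its adjacency matrix; a positive eigenvector is one all of whose entries are positive. For a graph with at least one edge, Hoffman's bound states $\chi(G)\ge h(G):=1-\lambda_{\max}(G)/\lambda_{\min}(G)$. A connected graph $G$ with at least one edge is called Hoffman colorable if $\chi(G)=h(G)$ (without rounding). A disconnected graph is called Hoffman colorable if every connected component is Hoffman colorable and the values $\lambda_{\max}$, $\lambda_{\min}$ and $\chi$ are the same for all components. With this convention every Hoffman colorable graph has a positive eigenvector (unique up to scaling if the graph is connected). If $G$ is Hoffman colorable, every optimal proper vertex coloring (one with $\chi(G)$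 colors) is called a Hoffman coloring. *)

theory Defs
  imports
    "Graph_Theory.Digraph_Component"
    "Jordan_Normal_Form.Spectral_Radius"
    "HOL-Library.Disjoint_Sets"
    "HOL-Library.FuncSet"
begin

text \<open>
  A finite simple undirected graph is an instance of the locale \<^locale>\<open>graph\<close>: a finite loopless
  symmetric digraph without parallel arcs, in which an edge \<open>uv\<close> is the pair of arcs
  \<open>(u,v)\<close>, \<open>(v,u)\<close>.
\<close>

section \<open>Adjacency matrix and eigenvalues\<close>

text \<open>
  The rows and columns of a matrix are numbered from \<open>0\<close>, so the adjacency matrix is formed
  along an arbitrary enumeration of the vertices. The lemma \<open>graph_eigenvector_iff\<close> below
  shows that this choice is immaterial.
\<close>

definition vertex_enum :: "('a, 'b) pre_digraph \<Rightarrow> nat \<Rightarrow> 'a" where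
  "vertex_enum G = (SOME f. bij_betw f {0..<card (verts G)} (verts G))"

definition adjacency_mat :: "('a, 'b) pre_digraph \<Rightarrow> real mat" where
  "adjacency_mat G = mat (card (verts G)) (card (verts G))
     (\<lambda>(i, j). if vertex_enum G i \<rightarrow>\<^bsub>G\<^esub> vertex_enum G j then 1 else 0)"

text \<open>
  A vector indexed by the vertices is a function on the vertex type; its values outside
  \<open>verts G\<close> are ignored.
\<close>

definition graph_eigenvector :: "('a, 'b) pre_digraph \<Rightarrow> ('a \<Rightarrow> real) \<Rightarrow> real \<Rightarrow> bool" where
  "graph_eigenvector G x \<theta> \<longleftrightarrow>
     eigenvector (adjacency_mat G) (vec (card (verts G)) (\<lambda>i. x (vertex_enum G i))) \<theta>"

definition positive_eigenvector :: "('a, 'b) pre_digraph \<Rightarrow> ('a \<Rightarrow> real) \<Rightarrow> bool" where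
  "positive_eigenvector G x \<longleftrightarrow> (\<exists>\<theta>. graph_eigenvector G x \<theta>) \<and> (\<forall>v\<in>verts G. 0 < x v)"

text \<open>
  The adjacency matrix is real symmetric, so all its eigenvalues are real and nothing is lost
  by taking the spectrum over the reals. Both values are meaningful only if \<open>verts G \<noteq> {}\<close>.
\<close>

definition lambda_max :: "('a, 'b) pre_digraph \<Rightarrow> real" where
  "lambda_max G = Max (spectrum (adjacency_mat G))"

definition lambda_min :: "('a, 'b) pre_digraph \<Rightarrow> real" where
  "lambda_min G = Min (spectrum (adjacency_mat G))"

lemma bij_betw_vertex_enum:
  assumes "finite (verts G)"
  shows "bij_betw (vertex_enum G) {0..<card (verts G)} (verts G)"
  unfolding vertex_enum_def using someI_ex[OF ex_bij_betw_nat_finite[OF assms]] .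

lemma graph_eigenvector_iff:
  assumes fin: "finite (verts G)"
  shows "graph_eigenvector G x \<theta> \<longleftrightarrow>
    (\<exists>v\<in>verts G. x v \<noteq> 0) \<and>
    (\<forall>u\<in>verts G. (\<Sum>v\<in>verts G. (if u \<rightarrow>\<^bsub>G\<^esub> v then 1 else 0) * x v) = \<theta> * x u)"
proof -
  let ?n = "card (verts G)" and ?f = "vertex_enum G"
  let ?x = "vec ?n (\<lambda>i. x (?f i))"
  note bij = bij_betw_vertex_enum[OF fin]
  have all_verts: "(\<forall>i<?n. P (?f i)) \<longleftrightarrow> (\<forall>u\<in>verts G. P u)" for P
    using bij_betw_imp_surj_on[OF bij] by (metis atLeast0LessThan image_iff lessThan_iff)
  have vec_eq: "v = w \<longleftrightarrow> (\<forall>i<?n. v $ i = w $ i)" if "dim_vec v = ?n" "dim_vec w = ?n"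
    for v w :: "real vec"
    using that by (auto intro: eq_vecI)
  have "?x = 0\<^sub>v ?n \<longleftrightarrow> (\<forall>i<?n. x (?f i) = 0)"
    by (subst vec_eq) simp_all
  also have "\<dots> \<longleftrightarrow> (\<forall>v\<in>verts G. x v = 0)"
    by (rule all_verts)
  finally have nonzero: "?x \<noteq> 0\<^sub>v ?n \<longleftrightarrow> (\<exists>v\<in>verts G. x v \<noteq> 0)"
    by blast
  have row: "(adjacency_mat G *\<^sub>v ?x) $ i =
      (\<Sum>v\<in>verts G. (if ?f i \<rightarrow>\<^bsub>G\<^esub> v then 1 else 0) * x v)" if "i < ?n" for i
  proof -
    have "(adjacency_mat G *\<^sub>v ?x) $ i =
        (\<Sum>j\<in>{0..<?n}. (if ?f i \<rightarrow>\<^bsub>G\<^esub> ?f j then 1 else 0) * x (?f j))"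
      using that by (simp add: adjacency_mat_def scalar_prod_def)
    also have "\<dots> = (\<Sum>v\<in>verts G. (if ?f i \<rightarrow>\<^bsub>G\<^esub> v then 1 else 0) * x v)"
      by (rule sum.reindex_bij_betw[OF bij])
    finally show ?thesis .
  qed
  have dim: "dim_row (adjacency_mat G) = ?n"
    by (simp add: adjacency_mat_def)
  have "adjacency_mat G *\<^sub>v ?x = \<theta> \<cdot>\<^sub>v ?x \<longleftrightarrow>
      (\<forall>i<?n. (\<Sum>v\<in>verts G. (if ?f i \<rightarrow>\<^bsub>G\<^esub> v then 1 else 0) * x v) = \<theta> * x (?f i))"
    by (subst vec_eq) (simp_all add: row dim del: index_mult_mat_vec)
  also have "\<dots> \<longleftrightarrow>
      (\<forall>u\<in>verts G. (\<Sum>v\<in>verts G. (if u \<rightarrow>\<^bsub>G\<^esub> v then 1 else 0) * x v) = \<theta> * x u)"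
    by (rule all_verts)
  finally show ?thesis
    using nonzero dim by (simp add: graph_eigenvector_def eigenvector_def)
qed

section \<open>Colorings\<close>

text \<open>
  A proper coloring with color set \<open>I\<close> is given by its family of color classes \<open>(V i)\<^sub>i\<close>.
\<close>

definition proper_coloring :: "('a, 'b) pre_digraph \<Rightarrow> 'i set \<Rightarrow> ('i \<Rightarrow> 'a set) \<Rightarrow> bool" where
  "proper_coloring G I V \<longleftrightarrow>
     finite I \<and> (\<Union>i\<in>I. V i) = verts G \<and> disjoint_family_on V I \<and>
     (\<forall>i\<in>I. \<forall>u\<in>V i. \<forall>v\<in>V i. \<not> u \<rightarrow>\<^bsub>G\<^esub> v)"

definition chromatic_number :: "('a, 'b) pre_digraph \<Rightarrow> nat" where
  "chromatic_number G = (LEAST k. \<exists>V. proper_coloring G {1..k} V)"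

section \<open>Hoffman colorability\<close>

definition hoffman_bound :: "('a, 'b) pre_digraph \<Rightarrow> real" where
  "hoffman_bound G = 1 - lambda_max G / lambda_min G"

text \<open>
  Since \<open>G\<close> is symmetric, its strongly connected components \<open>sccs\<close> are its connected
  components. In the library a connected digraph has a vertex by definition, so the graph without
  vertices falls into the second case, where it is excluded explicitly.
\<close>

definition hoffman_colorable :: "('a, 'b) pre_digraph \<Rightarrow> bool" where
  "hoffman_colorable G \<longleftrightarrow>
     (if Digraph_Component.connected G
      then arcs G \<noteq> {} \<and> real (chromatic_number G) = hoffman_bound G
      else verts G \<noteq> {} \<and>
        (\<forall>K\<in>pre_digraph.sccs G.
           arcs K \<noteq> {} \<and> real (chromatic_number K) = hoffman_bound K) \<and>
        (\<forall>K\<in>pre_digraph.sccs G. \<forall>L\<in>pre_digraph.sccs G.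
           lambda_max K = lambda_max L \<and> lambda_min K = lambda_min L \<and>
           chromatic_number K = chromatic_number L))"

definition hoffman_coloring :: "('a, 'b) pre_digraph \<Rightarrow> 'i set \<Rightarrow> ('i \<Rightarrow> 'a set) \<Rightarrow> bool" where
  "hoffman_coloring G I V \<longleftrightarrow>
     hoffman_colorable G \<and> proper_coloring G I V \<and> card I = chromatic_number G"

end

theory Submission
  imports Defs "HOL-Analysis.Function_Topology"
begin

text \<open>
  Put \<open>\<tau> = - \<lambda>\<^sub>m\<^sub>i\<^sub>n(G)\<close>. Equality in Hoffman's bound forces, for every color class \<open>V\<^sub>i\<close> and every
  vertex \<open>u\<close> outside it, that the entries of \<open>x\<close> over the neighbors of \<open>u\<close> in \<open>V\<^sub>i\<close> sum to \<open>\<tau> x\<^sub>u\<close>.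
  This condition is inherited by \<open>H\<close> and by each of its components. It makes \<open>x\<close> an eigenvector of
  \<open>H\<close> for \<open>(|C| - 1) \<tau>\<close>, and \<open>x\<^sub>i - x\<^sub>j\<close> one for \<open>-\<tau>\<close>, where \<open>x\<^sub>i\<close> is the part of \<open>x\<close> supported on
  \<open>V\<^sub>i\<close>. A positive eigenvector belongs to the largest eigenvalue, and no eigenvalue of an induced
  subgraph lies below \<open>-\<tau>\<close>, so both extreme eigenvalues are known; Hoffman's bound then shows that
  \<open>|C|\<close> colors are necessary.
\<close>

section \<open>Rayleigh quotients of symmetric forms\<close>


text \<open>Functions on the vertex type take the place of numbered vectors, so that passing to a
  subgraph needs no renumbering.\<close>

definition bilin :: "'a set \<Rightarrow> ('a \<Rightarrow> 'a \<Rightarrow> real) \<Rightarrow> ('a \<Rightarrow> real) \<Rightarrow> ('a \<Rightarrow> real) \<Rightarrow> real" where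
  "bilin S a f g = (\<Sum>u\<in>S. f u * (\<Sum>v\<in>S. a u v * g v))"

lemma bilin_add_left: "bilin S a (\<lambda>u. f u + g u) h = bilin S a f h + bilin S a g h"
  by (simp add: bilin_def distrib_right sum.distrib)

lemma bilin_scale_left: "bilin S a (\<lambda>u. c * f u) g = c * bilin S a f g"
  by (simp add: bilin_def sum_distrib_left mult.assoc)

lemma bilin_commute:
  assumes "\<And>u v. \<lbrakk>u \<in> S; v \<in> S\<rbrakk> \<Longrightarrow> a u v = a v u"
  shows "bilin S a f g = bilin S a g f"
proof -
  have "bilin S a f g = (\<Sum>u\<in>S. \<Sum>v\<in>S. f u * (a u v * g v))"
    by (simp add: bilin_def sum_distrib_left)
  also have "\<dots> = (\<Sum>v\<in>S. \<Sum>u\<in>S. f u * (a u v * g v))"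
    by (rule sum.swap)
  also have "\<dots> = (\<Sum>v\<in>S. \<Sum>u\<in>S. g v * (a v u * f u))"
    using assms by (intro sum.cong refl) simp
  also have "\<dots> = bilin S a g f"
    by (simp add: bilin_def sum_distrib_left)
  finally show ?thesis .
qed

text \<open>The expansion serves three kinds of test vector: the variation of a minimizer, the
  difference of two vertex indicators, and Hoffman's vectors.\<close>

lemma bilin_perturb:
  assumes "\<And>u v. \<lbrakk>u \<in> S; v \<in> S\<rbrakk> \<Longrightarrow> a u v = a v u"
  shows "bilin S a (\<lambda>u. f u + t * g u) (\<lambda>u. f u + t * g u) =
    bilin S a f f + 2 * t * bilin S a g f + t\<^sup>2 * bilin S a g g"
proof -
  have comm: "bilin S a f g = bilin S a g f" for f g
    using assms by (rule bilin_commute)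
  let ?h = "\<lambda>u. f u + t * g u"
  have *: "bilin S a ?h k = bilin S a f k + t * bilin S a g k" for k
    by (simp only: bilin_add_left bilin_scale_left)
  have "bilin S a ?h ?h = bilin S a ?h f + t * bilin S a ?h g"
    by (simp only: *[of ?h] comm[of f ?h] comm[of g ?h])
  also have "\<dots> = bilin S a f f + 2 * t * bilin S a g f + t\<^sup>2 * bilin S a g g"
    unfolding * using comm[of f g] by (simp add: algebra_simps power2_eq_square)
  finally show ?thesis .
qed

lemma bilin_eigen:
  assumes "\<forall>u\<in>S. (\<Sum>v\<in>S. a u v * g v) = \<theta> * g u"
  shows "bilin S a f g = \<theta> * (\<Sum>u\<in>S. f u * g u)"
  using assms by (simp add: bilin_def sum_distrib_left mult.left_commute cong: sum.cong)

lemma bilin_indicator: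
  assumes "finite S" "w \<in> S"
  shows "bilin S a (\<lambda>u. if u = w then 1 else 0) g = (\<Sum>v\<in>S. a w v * g v)"
  using assms by (simp add: bilin_def if_distrib[of "\<lambda>c. c * _"] cong: if_cong)

text \<open>The form minus \<open>\<theta>\<close> times the squared norm is nonnegative and
  vanishes at \<open>f\<close>, so its derivative there in each coordinate direction is zero. In
  direction \<open>w\<close> this derivative is twice the residual \<open>r\<close> of the
  eigenvalue equation.\<close>

lemma rayleigh_minimizer_eigen:
  assumes fin: "finite S"
    and sym: "\<And>u v. \<lbrakk>u \<in> S; v \<in> S\<rbrakk> \<Longrightarrow> a u v = a v u"
    and lower: "\<And>g. \<theta> * (\<Sum>u\<in>S. (g u)\<^sup>2) \<le> bilin S a g g"
    and attained: "bilin S a f f = \<theta> * (\<Sum>u\<in>S. (f u)\<^sup>2)"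
    and w: "w \<in> S"
  shows "(\<Sum>v\<in>S. a w v * f v) = \<theta> * f w"
proof -
  let ?e = "\<lambda>u. if u = w then 1 else 0 :: real"
  define r where "r = (\<Sum>v\<in>S. a w v * f v) - \<theta> * f w"
  \<comment> \<open>\<open>s\<close> bounds the quadratic coefficient from above, and the
    \<open>+ 1\<close> keeps it positive; at \<open>t = - r / s\<close> the resulting bound becomes
    \<open>- r\<^sup>2 / s\<close>.\<close>
  define s where "s = \<bar>a w w - \<theta>\<bar> + 1"
  have e: "bilin S a ?e g = (\<Sum>v\<in>S. a w v * g v)" for g
    using fin w by (rule bilin_indicator)
  have ee: "bilin S a ?e ?e = a w w"
    unfolding e using fin w by (simp add: if_distrib[of "\<lambda>c. _ * c"] cong: if_cong)
  have pos: "0 \<le> 2 * t * r + t\<^sup>2 * (a w w - \<theta>)" for t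
  proof -
    have "(\<Sum>u\<in>S. (f u + t * ?e u)\<^sup>2) = (\<Sum>u\<in>S. (f u)\<^sup>2 + (if u = w then 2 * t * f w + t\<^sup>2 else 0))"
      by (intro sum.cong refl) (simp add: power2_eq_square algebra_simps)
    also have "\<dots> = (\<Sum>u\<in>S. (f u)\<^sup>2) + 2 * t * f w + t\<^sup>2"
      using fin w by (simp add: sum.distrib)
    finally have sq: "(\<Sum>u\<in>S. (f u + t * ?e u)\<^sup>2) = (\<Sum>u\<in>S. (f u)\<^sup>2) + 2 * t * f w + t\<^sup>2" .
    have "bilin S a (\<lambda>u. f u + t * ?e u) (\<lambda>u. f u + t * ?e u) =
        bilin S a f f + 2 * t * bilin S a ?e f + t\<^sup>2 * bilin S a ?e ?e"
      using sym by (rule bilin_perturb)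
    with lower[of "\<lambda>u. f u + t * ?e u"] show ?thesis
      unfolding sq ee e attained r_def by (simp add: algebra_simps)
  qed
  have s: "s > 0" "a w w - \<theta> \<le> s"
    by (auto simp: s_def)
  have "0 \<le> 2 * (- r / s) * r + (- r / s)\<^sup>2 * (a w w - \<theta>)"
    by (rule pos)
  also have "\<dots> \<le> 2 * (- r / s) * r + (- r / s)\<^sup>2 * s"
    using s by (intro add_left_mono mult_left_mono) auto
  also have "\<dots> = - r\<^sup>2 / s"
    using s by (simp add: field_simps power2_eq_square)
  finally have "r\<^sup>2 \<le> 0"
    using s by (simp add: field_simps)
  then show ?thesis
    by (simp add: r_def)
qed

text \<open>The form is continuous, hence attains its minimum on a compact unit sphere; homogeneity
  extends the inequality to all functions.\<close>

lemma rayleigh_minimum_exists: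
  fixes a :: "'a \<Rightarrow> 'a \<Rightarrow> real"
  assumes fin: "finite S" and ne: "S \<noteq> {}"
  obtains f \<theta> where "\<exists>u\<in>S. f u \<noteq> 0"
    and "bilin S a f f = \<theta> * (\<Sum>u\<in>S. (f u)\<^sup>2)"
    and "\<And>g. \<theta> * (\<Sum>u\<in>S. (g u)\<^sup>2) \<le> bilin S a g g"
proof -
  \<comment> \<open>The type \<open>'a\<close> may be infinite, and the sphere leaves all values
    outside \<open>S\<close> free. Fixing them at \<open>0\<close>, with the others in
    \<open>[-1, 1]\<close>, gives a compact product by Tychonoff's theorem.\<close>
  let ?box = "PiE UNIV (\<lambda>u. if u \<in> S then {-1..1} else {0::real})"
  let ?sph = "{f. (\<Sum>u\<in>S. (f u)\<^sup>2) = (1::real)}"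
  have coord: "continuous_on A (\<lambda>f::'a \<Rightarrow> real. f u)" for A u
    by (rule continuous_on_subset[OF continuous_on_product_coordinates subset_UNIV])
  have "compactin (product_topology (\<lambda>i. euclidean) UNIV) ?box"
    by (subst compactin_PiE) auto
  then have "compact ?box"
    by (simp add: euclidean_product_topology)
  moreover have "closed ?sph"
    by (intro closed_Collect_eq continuous_intros coord)
  ultimately have comp: "compact (?box \<inter> ?sph)"
    by (rule compact_Int_closed)
  obtain u0 where u0: "u0 \<in> S"
    using ne by blast
  have "(\<lambda>u. if u = u0 then 1 else 0) \<in> ?box \<inter> ?sph"
    using u0 fin by (auto simp: if_distrib[of "\<lambda>c. c\<^sup>2"] cong: if_cong)
  then have ne': "?box \<inter> ?sph \<noteq> {}"
    by blast
  have "continuous_on (?box \<inter> ?sph) (\<lambda>f. bilin S a f f)"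
    unfolding bilin_def by (intro continuous_intros coord)
  from continuous_attains_inf[OF comp ne' this] obtain f
    where f: "f \<in> ?box \<inter> ?sph" and min: "\<And>g. g \<in> ?box \<inter> ?sph \<Longrightarrow> bilin S a f f \<le> bilin S a g g"
    by blast
  have lower: "bilin S a f f * (\<Sum>u\<in>S. (g u)\<^sup>2) \<le> bilin S a g g" for g
  proof (cases "\<forall>u\<in>S. g u = 0")
    case True
    then show ?thesis
      by (simp add: bilin_def)
  next
    case False
    define N where "N = (\<Sum>u\<in>S. (g u)\<^sup>2)"
    define c where "c = 1 / sqrt N"
    \<comment> \<open>The normalized function must vanish outside \<open>S\<close> to lie in the
      box; the form does not see those values.\<close>
    define h where "h u = (if u \<in> S then c * g u else 0)" for u
    have "N > 0"
      using False fin by (auto simp: N_def intro!: sum_pos2)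
    then have c: "c\<^sup>2 * N = 1"
      by (simp add: c_def power_divide)
    have "(\<Sum>u\<in>S. (h u)\<^sup>2) = c\<^sup>2 * N"
      by (simp add: h_def N_def sum_distrib_left power_mult_distrib cong: sum.cong)
    then have sph: "(\<Sum>u\<in>S. (h u)\<^sup>2) = 1"
      using c by simp
    have "(h u)\<^sup>2 \<le> 1" if "u \<in> S" for u
      using member_le_sum[of u S "\<lambda>u. (h u)\<^sup>2"] that fin sph by simp
    then have "\<bar>h u\<bar> \<le> 1" if "u \<in> S" for u
      using that by (simp add: abs_square_le_1)
    then have "h \<in> ?box"
      by (auto simp: abs_le_iff h_def)
    then have "bilin S a f f \<le> bilin S a h h"
      using sph by (intro min) simp
    also have "bilin S a h h = c\<^sup>2 * bilin S a g g"
      by (simp add: bilin_def h_def sum_distrib_left power2_eq_square mult_ac cong: sum.cong)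
    finally have "bilin S a f f * N \<le> c\<^sup>2 * bilin S a g g * N"
      using \<open>N > 0\<close> by (simp add: mult_right_mono)
    also have "\<dots> = bilin S a g g"
      using c by (simp add: mult.commute mult.left_commute)
    finally show ?thesis
      by (simp add: N_def)
  qed
  have "\<exists>u\<in>S. f u \<noteq> 0"
    using f by (rule_tac ccontr) auto
  then show ?thesis
    using that[of f "bilin S a f f"] f lower by simp
qed

section \<open>Extreme eigenvalues of a graph\<close>

abbreviation adj :: "('a, 'b) pre_digraph \<Rightarrow> 'a \<Rightarrow> 'a \<Rightarrow> real" where
  "adj G u v \<equiv> if u \<rightarrow>\<^bsub>G\<^esub> v then 1 else 0"

lemma adjacency_mat_carrier: "adjacency_mat G \<in> carrier_mat (card (verts G)) (card (verts G))"
  by (simp add: adjacency_mat_def)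

text \<open>Composing with the inverse of the vertex enumeration turns a numbered eigenvector into a
  function on vertices, the only kind of eigenvector handled from here on.\<close>

lemma spectrum_adjacency_mat:
  assumes fin: "finite (verts G)"
  shows "spectrum (adjacency_mat G) = {\<theta>. \<exists>f. graph_eigenvector G f \<theta>}"
proof (intro equalityI subsetI)
  fix \<theta> assume "\<theta> \<in> spectrum (adjacency_mat G)"
  then obtain y where y: "eigenvector (adjacency_mat G) y \<theta>"
    by (auto simp: spectrum_def eigenvalue_def)
  let ?n = "card (verts G)" and ?e = "vertex_enum G"
  have "dim_vec y = ?n"
    using y by (auto simp: eigenvector_def adjacency_mat_def)
  moreover have "the_inv_into {0..<?n} ?e (?e i) = i" if "i < ?n" for i
    using bij_betw_imp_inj_on[OF bij_betw_vertex_enum[OF fin]] that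
    by (intro the_inv_into_f_f) auto
  ultimately have "vec ?n (\<lambda>i. vec_index y (the_inv_into {0..<?n} ?e (?e i))) = y"
    by (intro eq_vecI) auto
  then have "graph_eigenvector G (\<lambda>u. vec_index y (the_inv_into {0..<?n} ?e u)) \<theta>"
    using y by (simp add: graph_eigenvector_def)
  then show "\<theta> \<in> {\<theta>. \<exists>f. graph_eigenvector G f \<theta>}"
    by blast
qed (auto simp: graph_eigenvector_def spectrum_def eigenvalue_def)

lemma finite_graph_eigenvalues:
  assumes "finite (verts G)"
  shows "finite {\<theta>. \<exists>f. graph_eigenvector G f \<theta>}"
  using card_finite_spectrum(1)[OF adjacency_mat_carrier] spectrum_adjacency_mat[OF assms] by metis

context graph
begin

lemma adj_commute: "adj G u v = adj G v u"
  using graph_symmetric by auto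

lemma adj_self: "\<not> u \<rightarrow> u"
  using no_loops by (auto simp: arcs_ends_def arc_to_ends_def)

lemma rayleigh_le_eigenvalue:
  assumes f: "graph_eigenvector G f \<theta>"
    and lower: "\<And>g. c * (\<Sum>u\<in>verts G. (g u)\<^sup>2) \<le> bilin (verts G) (adj G) g g"
  shows "c \<le> \<theta>"
proof -
  have nz: "\<exists>v\<in>verts G. f v \<noteq> 0"
    and eq: "\<forall>u\<in>verts G. (\<Sum>v\<in>verts G. adj G u v * f v) = \<theta> * f u"
    using f unfolding graph_eigenvector_iff[OF finite_verts] by auto
  have "c * (\<Sum>u\<in>verts G. (f u)\<^sup>2) \<le> \<theta> * (\<Sum>u\<in>verts G. (f u)\<^sup>2)"
    using lower[of f] bilin_eigen[where a = "adj G" and f = f, OF eq] by (simp add: power2_eq_square)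
  moreover have "0 < (\<Sum>u\<in>verts G. (f u)\<^sup>2)"
    using nz by (auto intro!: sum_pos2)
  ultimately show ?thesis
    by simp
qed

text \<open>A minimizer of the Rayleigh quotient is an eigenvector, and every eigenvalue is a value
  of the quotient, so the minimum is the least eigenvalue. In particular the spectrum is nonempty,
  which gives \<open>Min\<close> its meaning.\<close>

lemma lambda_min_rayleigh:
  assumes ne: "verts G \<noteq> {}"
  shows "\<exists>f. graph_eigenvector G f (lambda_min G)"
    and "lambda_min G * (\<Sum>u\<in>verts G. (g u)\<^sup>2) \<le> bilin (verts G) (adj G) g g"
proof -
  obtain f \<theta> where f: "\<exists>u\<in>verts G. f u \<noteq> 0"
    and att: "bilin (verts G) (adj G) f f = \<theta> * (\<Sum>u\<in>verts G. (f u)\<^sup>2)"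
    and lower: "\<And>g. \<theta> * (\<Sum>u\<in>verts G. (g u)\<^sup>2) \<le> bilin (verts G) (adj G) g g"
    using rayleigh_minimum_exists[OF finite_verts ne] by metis
  have eig: "graph_eigenvector G f \<theta>"
    unfolding graph_eigenvector_iff[OF finite_verts]
    using f rayleigh_minimizer_eigen[OF finite_verts adj_commute lower att] by simp
  have least: "\<theta> \<le> \<theta>'" if "graph_eigenvector G h \<theta>'" for h \<theta>'
    using that lower by (rule rayleigh_le_eigenvalue)
  have min: "lambda_min G = \<theta>"
    unfolding lambda_min_def spectrum_adjacency_mat[OF finite_verts]
    using eig least by (intro Min_eqI finite_graph_eigenvalues) auto
  show "\<exists>f. graph_eigenvector G f (lambda_min G)"
    using eig min by blast
  show "lambda_min G * (\<Sum>u\<in>verts G. (g u)\<^sup>2) \<le> bilin (verts G) (adj G) g g"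
    using lower min by simp
qed

lemma lambda_min_le:
  assumes "graph_eigenvector G f \<theta>"
  shows "lambda_min G \<le> \<theta>"
  unfolding lambda_min_def spectrum_adjacency_mat[OF finite_verts]
  using assms by (intro Min_le finite_graph_eigenvalues) auto

text \<open>Comparing an eigenvector with the positive one at the vertex where their ratio is largest.\<close>

lemma lambda_max_positive_eigenvector:
  assumes x: "graph_eigenvector G x \<theta>" and pos: "\<forall>u\<in>verts G. 0 < x u"
  shows "lambda_max G = \<theta>"
proof -
  have "\<theta>' \<le> \<theta>" if "graph_eigenvector G f \<theta>'" for f \<theta>'
  proof -
    have f: "\<exists>v\<in>verts G. f v \<noteq> 0" "\<forall>u\<in>verts G. (\<Sum>v\<in>verts G. adj G u v * f v) = \<theta>' * f u"
      using that unfolding graph_eigenvector_iff[OF finite_verts] by auto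
    define M where "M = Max ((\<lambda>u. \<bar>f u\<bar> / x u) ` verts G)"
    have ne: "verts G \<noteq> {}"
      using f(1) by auto
    then have "M \<in> (\<lambda>u. \<bar>f u\<bar> / x u) ` verts G"
      unfolding M_def by (intro Max_in) auto
    then obtain w where w: "w \<in> verts G" "M = \<bar>f w\<bar> / x w"
      by blast
    have "\<bar>f u\<bar> / x u \<le> M" if "u \<in> verts G" for u
      unfolding M_def using that by (intro Max_ge) auto
    then have M: "\<bar>f u\<bar> \<le> M * x u" if "u \<in> verts G" for u
      using that pos by (simp add: pos_divide_le_eq)
    obtain v where v: "v \<in> verts G" "f v \<noteq> 0"
      using f(1) by blast
    have "0 < M * x v"
      using M[of v] v by linarith
    \<comment> \<open>This makes \<open>f w\<close> nonzero, so that \<open>\<bar>f w\<bar>\<close>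
      can be cancelled at the end.\<close>
    then have "M > 0"
      using bspec[OF pos v(1)] by (simp add: zero_less_mult_iff)
    have "\<theta>' * \<bar>f w\<bar> \<le> \<bar>\<theta>' * f w\<bar>"
      by (simp add: abs_mult mult_right_mono)
    also have "\<theta>' * f w = (\<Sum>v\<in>verts G. adj G w v * f v)"
      using f(2) w(1) by simp
    also have "\<bar>\<dots>\<bar> \<le> (\<Sum>v\<in>verts G. adj G w v * (M * x v))"
      using M by (intro order.trans[OF sum_abs] sum_mono) (auto simp: abs_mult)
    also have "\<dots> = M * (\<Sum>v\<in>verts G. adj G w v * x v)"
      by (simp add: sum_distrib_left mult_ac)
    also have "\<dots> = \<theta> * (M * x w)"
      using x w(1) unfolding graph_eigenvector_iff[OF finite_verts] by simp
    also have "M * x w = \<bar>f w\<bar>"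
      using w bspec[OF pos w(1)] by simp
    finally have "\<theta>' * \<bar>f w\<bar> \<le> \<theta> * \<bar>f w\<bar>" .
    moreover have "0 < \<bar>f w\<bar>"
      using w bspec[OF pos w(1)] \<open>M > 0\<close> by auto
    ultimately show ?thesis
      by (simp add: mult_le_cancel_right)
  qed
  then show ?thesis
    unfolding lambda_max_def spectrum_adjacency_mat[OF finite_verts]
    using x by (intro Max_eqI finite_graph_eigenvalues) auto
qed

end

section \<open>Weight-regular colorings and Hoffman's bound\<close>

text \<open>\<open>chromatic_number\<close> ranges over the color sets \<open>{1..k}\<close> only,
  whereas the subgraph in the theorem is colored by an arbitrary set of colors; renumbering bridges
  the two.\<close>

lemma proper_coloring_numbered:
  assumes "proper_coloring G I V"
  shows "\<exists>W. proper_coloring G {1..card I} W"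
proof -
  have "finite I"
    using assms by (simp add: proper_coloring_def)
  from ex_bij_betw_nat_finite_1[OF this] obtain h where h: "bij_betw h {1..card I} I"
    by blast
  have "(\<Union>i\<in>{1..card I}. (V \<circ> h) i) = (\<Union>i\<in>h ` {1..card I}. V i)"
    by simp
  then have "(\<Union>i\<in>{1..card I}. (V \<circ> h) i) = (\<Union>i\<in>I. V i)"
    by (simp only: bij_betw_imp_surj_on[OF h])
  moreover have "disjoint_family_on (V \<circ> h) {1..card I}"
    using assms bij_betw_imp_surj_on[OF h] bij_betw_imp_inj_on[OF h]
    unfolding proper_coloring_def disjoint_family_on_def inj_on_def comp_def by blast
  ultimately have "proper_coloring G {1..card I} (V \<circ> h)"
    using assms bij_betwE[OF h] by (simp add: proper_coloring_def) blast
  then show ?thesis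
    by blast
qed

lemma chromatic_number_le:
  assumes "proper_coloring G I V"
  shows "chromatic_number G \<le> card I"
  unfolding chromatic_number_def using assms by (intro Least_le proper_coloring_numbered)

lemma chromatic_number_attained:
  assumes "proper_coloring G I V"
  shows "\<exists>W. proper_coloring G {1..chromatic_number G} W"
  unfolding chromatic_number_def using proper_coloring_numbered[OF assms] by (rule LeastI)

text \<open>A weighted form of regularity between classes: for constant nonzero \<open>x\<close> it
  says that each vertex has exactly \<open>\<tau>\<close> neighbors in every class other than its
  own.\<close>

definition weight_regular ::
  "('a, 'b) pre_digraph \<Rightarrow> 'i set \<Rightarrow> ('i \<Rightarrow> 'a set) \<Rightarrow> ('a \<Rightarrow> real) \<Rightarrow> real \<Rightarrow> bool" where
  "weight_regular G I V x \<tau> \<longleftrightarrow> proper_coloring G I V \<and>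
     (\<forall>i\<in>I. \<forall>u\<in>verts G - V i. (\<Sum>v\<in>V i. adj G u v * x v) = \<tau> * x u)"

lemma adj_induce:
  assumes "u \<in> S" "v \<in> S"
  shows "u \<rightarrow>\<^bsub>G \<restriction> S\<^esub> v \<longleftrightarrow> u \<rightarrow>\<^bsub>G\<^esub> v"
  using assms by (auto simp: arcs_ends_def arc_to_ends_def)

lemma proper_coloring_induce:
  assumes col: "proper_coloring G I V" and "J \<subseteq> I" and "S \<subseteq> (\<Union>i\<in>J. V i)"
  shows "proper_coloring (G \<restriction> S) J (\<lambda>i. V i \<inter> S)"
  using assms unfolding proper_coloring_def disjoint_family_on_def
  by (auto intro: finite_subset simp: adj_induce) blast

context graph
begin

lemma graph_induce:
  assumes "S \<subseteq> verts G"
  shows "graph (G \<restriction> S)"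
proof -
  have ind: "induced_subgraph (G \<restriction> S) G"
    using assms by (rule induced_induce)
  interpret D: digraph "G \<restriction> S"
    using ind by (rule digraphI_induced)
  interpret Y: sym_digraph "G \<restriction> S"
    using ind by (rule induced_graph_imp_graph)
  show ?thesis
    by unfold_locales
qed

lemma lambda_min_greatest_lower:
  assumes ne: "verts G \<noteq> {}"
    and lower: "\<And>g. c * (\<Sum>u\<in>verts G. (g u)\<^sup>2) \<le> bilin (verts G) (adj G) g g"
  shows "c \<le> lambda_min G"
proof -
  obtain f where "graph_eigenvector G f (lambda_min G)"
    using lambda_min_rayleigh(1)[OF ne] by blast
  then show ?thesis
    using lower by (rule rayleigh_le_eigenvalue)
qed

text \<open>The difference of the indicators of two adjacent vertices gives the form the value
  -2.\<close>

lemma lambda_min_neg: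
  assumes "arcs G \<noteq> {}"
  shows "lambda_min G < 0"
proof -
  obtain u v where uv: "u \<rightarrow> v"
    using assms by (auto simp: arcs_ends_def arc_to_ends_def)
  then have V: "u \<in> verts G" "v \<in> verts G" and "u \<noteq> v"
    using adj_self by (auto dest: adj_in_verts)
  let ?e = "\<lambda>w. if w = u then 1 else 0 :: real" and ?f = "\<lambda>w. if w = v then 1 else 0 :: real"
  let ?g = "\<lambda>w. ?e w + (-1) * ?f w"
  have delta: "bilin (verts G) (adj G) (\<lambda>w. if w = s then 1 else 0) (\<lambda>w. if w = t then 1 else 0) = adj G s t"
    if "s \<in> verts G" "t \<in> verts G" for s t
    using that by (simp add: bilin_indicator if_distrib[of "\<lambda>c. _ * c"] cong: if_cong)
  have "bilin (verts G) (adj G) ?g ?g =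
      bilin (verts G) (adj G) ?e ?e + 2 * (-1) * bilin (verts G) (adj G) ?f ?e
      + (-1)\<^sup>2 * bilin (verts G) (adj G) ?f ?f"
    using adj_commute by (rule bilin_perturb)
  also have "\<dots> = -2"
    using V uv graph_symmetric[OF uv] adj_self by (simp add: delta)
  finally have "bilin (verts G) (adj G) ?g ?g = -2" .
  moreover have "lambda_min G * (\<Sum>w\<in>verts G. (?g w)\<^sup>2) \<le> bilin (verts G) (adj G) ?g ?g"
    using V by (intro lambda_min_rayleigh(2)) auto
  ultimately have "lambda_min G * (\<Sum>w\<in>verts G. (?g w)\<^sup>2) < 0"
    by linarith
  moreover have "0 \<le> (\<Sum>w\<in>verts G. (?g w)\<^sup>2)"
    by (intro sum_nonneg) simp
  ultimately show ?thesis
    by (auto simp: mult_less_0_iff)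
qed

section \<open>Sums over color classes\<close>

lemma sum_color_classes:
  assumes "proper_coloring G I V"
  shows "(\<Sum>u\<in>verts G. f u) = (\<Sum>i\<in>I. \<Sum>u\<in>V i. f u)"
proof -
  have "finite (\<Union>i\<in>I. V i)"
    using assms by (simp add: proper_coloring_def)
  then have "\<forall>i\<in>I. finite (V i)"
    by (meson UN_upper finite_subset)
  then have "(\<Sum>u\<in>(\<Union>i\<in>I. V i). f u) = (\<Sum>i\<in>I. \<Sum>u\<in>V i. f u)"
    using assms by (intro sum.UNION_disjoint) (auto simp: proper_coloring_def disjoint_family_on_def)
  then show ?thesis
    using assms by (simp add: proper_coloring_def)
qed

lemma sum_restrict_color_class:
  fixes f g :: "'a \<Rightarrow> real"
  assumes "proper_coloring G I V" "i \<in> I"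
  shows "(\<Sum>u\<in>verts G. f u * (if u \<in> V i then g u else 0)) = (\<Sum>u\<in>V i. f u * g u)"
proof -
  have "V i \<subseteq> verts G"
    using assms by (auto simp: proper_coloring_def)
  then show ?thesis
    by (intro sum.mono_neutral_cong_right) auto
qed

lemma sum_adj_own_class:
  assumes "proper_coloring G I V" "i \<in> I" "u \<in> V i"
  shows "(\<Sum>v\<in>V i. adj G u v * x v) = 0"
  using assms by (intro sum.neutral) (auto simp: proper_coloring_def)

section \<open>Hoffman's inequality and its equality case\<close>

text \<open>
  Hoffman's argument: test the form \<open>A + \<tau>\<close> on the vectors \<open>x - k x\<^sub>i\<close>, where \<open>k\<close> is the number
  of colors. In the case of equality each of them is an eigenvector for \<open>-\<tau>\<close>.
\<close>

lemma hoffman_test_vectors: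
  assumes x: "graph_eigenvector G x \<theta>" and col: "proper_coloring G I V"
  defines "w \<equiv> \<lambda>i u. x u + (- real (card I)) * (if u \<in> V i then x u else 0)"
  shows "(\<Sum>i\<in>I. bilin (verts G) (adj G) (w i) (w i) + \<tau> * (\<Sum>u\<in>verts G. (w i u)\<^sup>2)) =
    real (card I) * (\<tau> * (real (card I) - 1) - \<theta>) * (\<Sum>u\<in>verts G. (x u)\<^sup>2)"
proof -
  let ?B = "bilin (verts G) (adj G)" and ?k = "real (card I)"
  let ?z = "\<lambda>i u. if u \<in> V i then x u else 0"
  define N where "N i = (\<Sum>u\<in>V i. (x u)\<^sup>2)" for i
  define M where "M = (\<Sum>u\<in>verts G. (x u)\<^sup>2)"
  have eq: "\<forall>u\<in>verts G. (\<Sum>v\<in>verts G. adj G u v * x v) = \<theta> * x u"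
    using x unfolding graph_eigenvector_iff[OF finite_verts] by auto
  have M: "M = (\<Sum>i\<in>I. N i)"
    unfolding M_def N_def using col by (rule sum_color_classes)
  have xx: "?B x x = \<theta> * M"
    unfolding M_def bilin_eigen[where a = "adj G" and f = x, OF eq] by (simp add: power2_eq_square)
  have "?B (w i) (w i) + \<tau> * (\<Sum>u\<in>verts G. (w i u)\<^sup>2) =
      (\<theta> + \<tau>) * M + ?k * (\<tau> * ?k - 2 * (\<theta> + \<tau>)) * N i" if i: "i \<in> I" for i
  proof -
    have zsum: "(\<Sum>u\<in>verts G. f u * ?z i u) = (\<Sum>u\<in>V i. f u * x u)" for f
      using col i by (rule sum_restrict_color_class)
    have "?B (?z i) x = \<theta> * (\<Sum>u\<in>verts G. x u * ?z i u)"
      unfolding bilin_eigen[where a = "adj G" and f = "?z i", OF eq] by (simp add: mult.commute)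
    then have zx: "?B (?z i) x = \<theta> * N i"
      unfolding zsum by (simp add: N_def power2_eq_square)
    \<comment> \<open>A color class is independent, so the form vanishes on the part of
      \<open>x\<close> supported on it.\<close>
    have zz: "?B (?z i) (?z i) = 0"
      unfolding bilin_def zsum using sum_adj_own_class[OF col i] by (intro sum.neutral) auto
    have "(\<Sum>u\<in>verts G. (w i u)\<^sup>2) = (\<Sum>u\<in>verts G. (x u)\<^sup>2 + (?k\<^sup>2 - 2 * ?k) * (x u * ?z i u))"
      by (intro sum.cong refl) (simp add: w_def power2_eq_square algebra_simps)
    then have "(\<Sum>u\<in>verts G. (w i u)\<^sup>2) = M + (?k\<^sup>2 - 2 * ?k) * N i"
      by (simp add: sum.distrib M_def N_def zsum power2_eq_square flip: sum_distrib_left)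
    moreover have "?B (w i) (w i) = ?B x x + 2 * (- ?k) * ?B (?z i) x + (- ?k)\<^sup>2 * ?B (?z i) (?z i)"
      unfolding w_def using adj_commute by (rule bilin_perturb)
    ultimately show ?thesis
      by (simp only: xx zx zz) (simp add: power2_eq_square algebra_simps)
  qed
  \<comment> \<open>Summing over all classes replaces the unknown norms \<open>N i\<close> by their
    total \<open>M\<close>.\<close>
  then have "(\<Sum>i\<in>I. ?B (w i) (w i) + \<tau> * (\<Sum>u\<in>verts G. (w i u)\<^sup>2)) =
      ?k * ((\<theta> + \<tau>) * M) + ?k * (\<tau> * ?k - 2 * (\<theta> + \<tau>)) * M"
    by (simp add: sum.distrib M flip: sum_distrib_left)
  then show ?thesis
    by (simp add: M_def algebra_simps)
qed

text \<open>By \<open>lower\<close> every summand in \<open>hoffman_test_vectors\<close> is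
  nonnegative, hence so is the factor \<open>\<tau> * (k - 1) - \<theta>\<close>, where
  \<open>k\<close> is the number of colors. With \<open>- \<tau>\<close> the smallest and
  \<open>\<theta>\<close> the largest eigenvalue this is Hoffman's bound.\<close>

lemma hoffman_inequality:
  assumes x: "graph_eigenvector G x \<theta>" and col: "proper_coloring G I V"
    and lower: "\<And>g. - \<tau> * (\<Sum>u\<in>verts G. (g u)\<^sup>2) \<le> bilin (verts G) (adj G) g g"
  shows "\<theta> \<le> \<tau> * (real (card I) - 1)"
proof -
  let ?w = "\<lambda>i u. x u + (- real (card I)) * (if u \<in> V i then x u else 0)"
  have nz: "\<exists>v\<in>verts G. x v \<noteq> 0"
    using x unfolding graph_eigenvector_iff[OF finite_verts] by auto
  then have "0 < card I"
    using col by (auto simp: proper_coloring_def card_gt_0_iff)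
  moreover have "0 < (\<Sum>u\<in>verts G. (x u)\<^sup>2)"
    using nz by (auto intro!: sum_pos2)
  moreover have "0 \<le> (\<Sum>i\<in>I. bilin (verts G) (adj G) (?w i) (?w i) + \<tau> * (\<Sum>u\<in>verts G. (?w i u)\<^sup>2))"
  proof (rule sum_nonneg)
    fix i
    show "0 \<le> bilin (verts G) (adj G) (?w i) (?w i) + \<tau> * (\<Sum>u\<in>verts G. (?w i u)\<^sup>2)"
      using lower[of "?w i"] by simp
  qed
  ultimately show ?thesis
    unfolding hoffman_test_vectors[OF x col] by (simp add: zero_le_mult_iff)
qed

text \<open>In the tight case nonnegative summands add up to zero, so each test vector minimizes the
  Rayleigh quotient and satisfies the eigenvalue equation for \<open>- \<tau>\<close>.\<close>

lemma hoffman_equality_weight_regular: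
  assumes x: "graph_eigenvector G x \<theta>" and col: "proper_coloring G I V"
    and lower: "\<And>g. - \<tau> * (\<Sum>u\<in>verts G. (g u)\<^sup>2) \<le> bilin (verts G) (adj G) g g"
    and tight: "\<theta> = \<tau> * (real (card I) - 1)"
  shows "weight_regular G I V x \<tau>"
proof -
  let ?B = "bilin (verts G) (adj G)" and ?k = "real (card I)"
  let ?z = "\<lambda>i u. if u \<in> V i then x u else 0"
  let ?w = "\<lambda>i u. x u + (- ?k) * ?z i u"
  let ?q = "\<lambda>i. ?B (?w i) (?w i) + \<tau> * (\<Sum>u\<in>verts G. (?w i u)\<^sup>2)"
  have eq: "\<forall>u\<in>verts G. (\<Sum>v\<in>verts G. adj G u v * x v) = \<theta> * x u"
    using x unfolding graph_eigenvector_iff[OF finite_verts] by auto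
  have fin: "finite I"
    using col by (simp add: proper_coloring_def)
  have nonneg: "0 \<le> ?q i" for i
    using lower[of "?w i"] by simp
  have "(\<Sum>i\<in>I. ?q i) = 0"
    unfolding hoffman_test_vectors[OF x col] tight by simp
  then have q: "\<And>i. i \<in> I \<Longrightarrow> ?q i = 0"
    using sum_nonneg_eq_0_iff[OF fin, of ?q] nonneg by blast
  have "(\<Sum>v\<in>V i. adj G u v * x v) = \<tau> * x u" if i: "i \<in> I" and u: "u \<in> verts G - V i" for i u
  proof -
    have att: "?B (?w i) (?w i) = - \<tau> * (\<Sum>u\<in>verts G. (?w i u)\<^sup>2)"
      using q[OF i] by linarith
    have eigen: "(\<Sum>v\<in>verts G. adj G u v * ?w i v) = - \<tau> * ?w i u"
      using u by (intro rayleigh_minimizer_eigen[OF finite_verts adj_commute lower att]) auto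
    have "(\<Sum>v\<in>verts G. adj G u v * ?w i v) =
        (\<Sum>v\<in>verts G. adj G u v * x v + (- ?k) * (adj G u v * ?z i v))"
      by (intro sum.cong refl) (simp add: algebra_simps)
    then have expand: "(\<Sum>v\<in>verts G. adj G u v * ?w i v) = \<theta> * x u + (- ?k) * (\<Sum>v\<in>V i. adj G u v * x v)"
      using eq u by (simp only: sum.distrib sum_restrict_color_class[OF col i] DiffD1 flip: sum_distrib_left)
    \<comment> \<open>At \<open>u\<close> outside \<open>V i\<close> the test vector equals
      \<open>x\<close>, and \<open>\<theta> + \<tau> = \<tau> * k\<close> by \<open>tight\<close>,
      with \<open>k\<close> the number of colors.\<close>
    have "?k * (\<Sum>v\<in>V i. adj G u v * x v) = ?k * (\<tau> * x u)"
      using eigen[unfolded expand] u by (auto simp: tight algebra_simps)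
    then show ?thesis
      using i fin by auto
  qed
  then show ?thesis
    using col by (simp add: weight_regular_def)
qed

section \<open>Spectral consequences of weight-regularity\<close>

lemma weight_regular_class_sum:
  assumes "weight_regular G I V x \<tau>" "i \<in> I" "u \<in> verts G"
  shows "(\<Sum>v\<in>V i. adj G u v * x v) = (if u \<in> V i then 0 else \<tau> * x u)"
  using assms sum_adj_own_class[of I V i u x] by (auto simp: weight_regular_def)

text \<open>The class of \<open>u\<close> contributes nothing to its row sum, and each of the other
  classes contributes \<open>\<tau> * x u\<close>.\<close>

lemma weight_regular_eigenvector:
  assumes wr: "weight_regular G I V x \<tau>" and nz: "\<exists>u\<in>verts G. x u \<noteq> 0"
  shows "graph_eigenvector G x (\<tau> * (real (card I) - 1))"
proof -
  have col: "proper_coloring G I V" and fin: "finite I"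
    using wr by (auto simp: weight_regular_def proper_coloring_def)
  have "(\<Sum>v\<in>verts G. adj G u v * x v) = \<tau> * (real (card I) - 1) * x u" if u: "u \<in> verts G" for u
  proof -
    obtain j where j: "j \<in> I" "u \<in> V j"
      using col u unfolding proper_coloring_def by blast
    have "u \<notin> V i" if "i \<in> I" "i \<noteq> j" for i
      using that j col by (auto simp: proper_coloring_def disjoint_family_on_def)
    then have "(\<Sum>v\<in>V i. adj G u v * x v) = (if i = j then 0 else \<tau> * x u)" if "i \<in> I" for i
      using weight_regular_class_sum[OF wr that u] that j by (cases "i = j") auto
    then have "(\<Sum>v\<in>verts G. adj G u v * x v) = (\<Sum>i\<in>I. if i = j then 0 else \<tau> * x u)"
      unfolding sum_color_classes[OF col] by (intro sum.cong refl)
    also have "\<dots> = (\<Sum>i\<in>I - {j}. \<tau> * x u)"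
      using fin by (intro sum.mono_neutral_cong_right) auto
    also have "\<dots> = \<tau> * (real (card I) - 1) * x u"
      using j fin card_gt_0_iff[of I] by (auto simp: of_nat_diff)
    finally show ?thesis .
  qed
  then show ?thesis
    using nz unfolding graph_eigenvector_iff[OF finite_verts] by blast
qed

text \<open>At a vertex of \<open>V i\<close> only the part on \<open>V j\<close> contributes, with
  a negative sign; in \<open>V j\<close> the roles are exchanged, and elsewhere the two
  contributions cancel.\<close>

lemma weight_regular_difference_eigenvector:
  assumes wr: "weight_regular G I V x \<tau>" and ij: "i \<in> I" "j \<in> I" "i \<noteq> j"
    and nz: "\<exists>u\<in>V i. x u \<noteq> 0"
  shows "graph_eigenvector G
    (\<lambda>u. (if u \<in> V i then x u else 0) - (if u \<in> V j then x u else 0)) (- \<tau>)"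
proof -
  have col: "proper_coloring G I V" and disj: "V i \<inter> V j = {}" and sub: "V i \<subseteq> verts G"
    using wr ij by (auto simp: weight_regular_def proper_coloring_def disjoint_family_on_def)
  have "(\<Sum>v\<in>verts G. adj G u v * ((if v \<in> V i then x v else 0) - (if v \<in> V j then x v else 0))) =
      - \<tau> * ((if u \<in> V i then x u else 0) - (if u \<in> V j then x u else 0))" if u: "u \<in> verts G" for u
    using disj
    by (auto simp add: right_diff_distrib sum_subtractf sum_restrict_color_class[OF col ij(1)]
        sum_restrict_color_class[OF col ij(2)] weight_regular_class_sum[OF wr _ u] ij
        simp del: mult_eq_0_iff)
  moreover obtain v where "v \<in> V i" "x v \<noteq> 0"
    using nz by blast
  ultimately show ?thesis
    using disj sub unfolding graph_eigenvector_iff[OF finite_verts] by (auto intro!: bexI[of _ v])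
qed

text \<open>The converse of the equality case: weight-regularity and the lower bound on the form
  determine both extreme eigenvalues and the chromatic number. These hypotheses pass to the subgraph
  in the theorem and to its components.\<close>

lemma weight_regular_hoffman:
  assumes wr: "weight_regular G I V x \<tau>" and \<tau>: "0 < \<tau>" and I: "2 \<le> card I"
    and ne: "verts G \<noteq> {}" and pos: "\<forall>u\<in>verts G. 0 < x u"
    and lower: "\<And>g. - \<tau> * (\<Sum>u\<in>verts G. (g u)\<^sup>2) \<le> bilin (verts G) (adj G) g g"
  shows "graph_eigenvector G x (lambda_max G)"
    and "lambda_max G = \<tau> * (real (card I) - 1)"
    and "lambda_min G = - \<tau>"
    and "chromatic_number G = card I"
    and "arcs G \<noteq> {}"
    and "real (chromatic_number G) = hoffman_bound G"
proof -
  have col: "proper_coloring G I V" and fin: "finite I"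
    using wr by (auto simp: weight_regular_def proper_coloring_def)
  obtain u where u: "u \<in> verts G"
    using ne by blast
  then have xu: "x u \<noteq> 0"
    using pos by force
  have eig: "graph_eigenvector G x (\<tau> * (real (card I) - 1))"
    using u xu by (intro weight_regular_eigenvector[OF wr]) blast
  show max: "lambda_max G = \<tau> * (real (card I) - 1)"
    using eig pos by (rule lambda_max_positive_eigenvector)
  then show "graph_eigenvector G x (lambda_max G)"
    using eig by simp
  obtain i where i: "i \<in> I" "u \<in> V i"
    using col u unfolding proper_coloring_def by blast
  \<comment> \<open>A second color supplies both the eigenvector for \<open>- \<tau>\<close> and a
    neighbor of \<open>u\<close>.\<close>
  have "I \<noteq> {i}"
    using I by auto
  then obtain j where j: "j \<in> I" "i \<noteq> j"
    using i by blast
  show min: "lambda_min G = - \<tau>"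
  proof (rule antisym)
    show "lambda_min G \<le> - \<tau>"
      using i xu by (intro lambda_min_le[OF weight_regular_difference_eigenvector[OF wr i(1) j]]) blast
    show "- \<tau> \<le> lambda_min G"
      using ne lower by (rule lambda_min_greatest_lower)
  qed
  have "u \<notin> V j"
    using i j col by (auto simp: proper_coloring_def disjoint_family_on_def)
  then have "(\<Sum>v\<in>V j. adj G u v * x v) \<noteq> 0"
    using weight_regular_class_sum[OF wr j(1) u] \<tau> xu by simp
  then obtain v where "adj G u v * x v \<noteq> 0"
    by (rule sum.not_neutral_contains_not_neutral)
  then have "u \<rightarrow> v"
    by (simp split: if_splits)
  then show "arcs G \<noteq> {}"
    by (auto simp: arcs_ends_def)
  show chi: "chromatic_number G = card I"
  proof (rule antisym)
    show "chromatic_number G \<le> card I"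
      using col by (rule chromatic_number_le)
    \<comment> \<open>Hoffman's inequality for an optimal coloring \<open>W\<close>, with
      \<open>\<theta> = \<tau> * (card I - 1)\<close>, shows that it has at least
      \<open>card I\<close> colors.\<close>
    obtain W where "proper_coloring G {1..chromatic_number G} W"
      using chromatic_number_attained[OF col] by blast
    from hoffman_inequality[OF eig this lower] show "card I \<le> chromatic_number G"
      using \<tau> by simp
  qed
  show "real (chromatic_number G) = hoffman_bound G"
    unfolding hoffman_bound_def max min chi using \<tau> by simp
qed

section \<open>Inheritance by induced subgraphs\<close>

text \<open>Extending a function by zero changes neither its norm nor the form. This is the part of
  eigenvalue interlacing that keeps the smallest eigenvalue from dropping.\<close>

lemma rayleigh_induce:
  assumes S: "S \<subseteq> verts G"
    and lower: "\<And>g. c * (\<Sum>u\<in>verts G. (g u)\<^sup>2) \<le> bilin (verts G) (adj G) g g"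
  shows "c * (\<Sum>u\<in>verts (G \<restriction> S). (g u)\<^sup>2) \<le> bilin (verts (G \<restriction> S)) (adj (G \<restriction> S)) g g"
proof -
  let ?h = "\<lambda>u. if u \<in> S then g u else 0"
  have *: "(\<Sum>u\<in>verts G. f u * ?h u) = (\<Sum>u\<in>S. f u * g u)" for f
    using S by (intro sum.mono_neutral_cong_right) auto
  have "bilin (verts G) (adj G) ?h ?h = (\<Sum>u\<in>verts G. (\<Sum>v\<in>verts G. adj G u v * ?h v) * ?h u)"
    unfolding bilin_def by (intro sum.cong refl mult.commute)
  also have "\<dots> = (\<Sum>u\<in>S. (\<Sum>v\<in>S. adj G u v * g v) * g u)"
    by (simp only: *)
  also have "\<dots> = bilin (verts (G \<restriction> S)) (adj (G \<restriction> S)) g g"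
    by (simp add: bilin_def adj_induce mult.commute cong: sum.cong)
  finally show ?thesis
    using lower[of ?h] *[of ?h] by (simp add: power2_eq_square cong: sum.cong)
qed

text \<open>By \<open>closed\<close>, no neighbor of a vertex of \<open>S\<close> in a kept class is
  lost, so the class sums do not change. This covers both dropping color classes, with
  \<open>S\<close> the union of the kept ones, and passing to a component, with all classes
  kept.\<close>

lemma weight_regular_induce:
  assumes wr: "weight_regular G I V x \<tau>" and J: "J \<subseteq> I" and S: "S \<subseteq> (\<Union>i\<in>J. V i)"
    and closed: "\<And>u v. \<lbrakk>u \<in> S; v \<in> (\<Union>i\<in>J. V i); u \<rightarrow> v\<rbrakk> \<Longrightarrow> v \<in> S"
  shows "weight_regular (G \<restriction> S) J (\<lambda>i. V i \<inter> S) x \<tau>"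
proof -
  have col: "proper_coloring G I V"
    using wr by (simp add: weight_regular_def)
  have "(\<Sum>v\<in>V i \<inter> S. adj (G \<restriction> S) u v * x v) = \<tau> * x u"
    if i: "i \<in> J" and u: "u \<in> verts (G \<restriction> S) - V i \<inter> S" for i u
  proof -
    have sub: "\<And>j. j \<in> I \<Longrightarrow> V j \<subseteq> verts G"
      using col by (auto simp: proper_coloring_def)
    have "(\<Sum>v\<in>V i \<inter> S. adj (G \<restriction> S) u v * x v) = (\<Sum>v\<in>V i \<inter> S. adj G u v * x v)"
      using u by (intro sum.cong) (auto simp: adj_induce)
    also have "\<dots> = (\<Sum>v\<in>V i. adj G u v * x v)"
      using closed[of u] u i J sub finite_subset[OF sub finite_verts]
      by (intro sum.mono_neutral_left) auto
    also have "\<dots> = \<tau> * x u"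
    proof -
      have "u \<in> verts G"
        using u S J sub by fastforce
      then have "u \<in> verts G - V i" "i \<in> I"
        using u i J by auto
      then show ?thesis
        using wr by (simp add: weight_regular_def)
    qed
    finally show ?thesis .
  qed
  then show ?thesis
    using proper_coloring_induce[OF col J S] unfolding weight_regular_def by blast
qed

section \<open>Components\<close>

lemma scc_closed:
  assumes "S \<in> sccs_verts" "u \<in> S" "u \<rightarrow> v"
  shows "v \<in> S"
  using assms graph_symmetric[of u v] unfolding in_sccs_verts_conv_reachable by blast

text \<open>No arc joins two components, so their colorings with the common color set
  \<open>{1..k}\<close> can be merged color by color.\<close>

lemma chromatic_number_le_sccs:
  assumes k: "\<And>S. S \<in> sccs_verts \<Longrightarrow> chromatic_number (G \<restriction> S) = k" and col: "proper_coloring G I V"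
  shows "chromatic_number G \<le> k"
proof -
  have "\<exists>W. proper_coloring (G \<restriction> S) {1..k} W" if S: "S \<in> sccs_verts" for S
  proof -
    have "S \<subseteq> (\<Union>i\<in>I. V i)"
      using sccs_verts_subsets[OF S] col by (simp add: proper_coloring_def)
    from chromatic_number_attained[OF proper_coloring_induce[OF col subset_refl this]]
    show ?thesis
      using k[OF S] by simp
  qed
  then obtain W where W: "\<And>S. S \<in> sccs_verts \<Longrightarrow> proper_coloring (G \<restriction> S) {1..k} (W S)"
    by metis
  define U where "U i = (\<Union>S\<in>sccs_verts. W S i)" for i
  have sub: "u \<in> S" if "S \<in> sccs_verts" "u \<in> W S i" "i \<in> {1..k}" for S u i
    using W[OF that(1)] that(2,3) by (auto simp: proper_coloring_def)
  have same: "S = T" if "S \<in> sccs_verts" "T \<in> sccs_verts" "u \<in> S" "u \<in> T" for S T u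
    using sccs_verts_disjoint[OF that(1,2)] that(3,4) by blast
  have "proper_coloring G {1..k} U"
    unfolding proper_coloring_def
  proof (intro conjI ballI)
    show "(\<Union>i\<in>{1..k}. U i) = verts G"
    proof (intro equalityI subsetI)
      fix u assume "u \<in> (\<Union>i\<in>{1..k}. U i)"
      then show "u \<in> verts G"
        using sub sccs_verts_subsets unfolding U_def by blast
    next
      fix u assume u: "u \<in> verts G"
      then have S: "scc_of u \<in> sccs_verts" "u \<in> scc_of u"
        by (rule scc_of_in_sccs_verts, rule in_scc_of_self)
      then have "u \<in> (\<Union>i\<in>{1..k}. W (scc_of u) i)"
        using W[OF S(1)] by (simp add: proper_coloring_def)
      then show "u \<in> (\<Union>i\<in>{1..k}. U i)"
        using S(1) unfolding U_def by blast
    qed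
    show "disjoint_family_on U {1..k}"
      unfolding disjoint_family_on_def
    proof (intro ballI impI)
      fix i j assume ij: "i \<in> {1..k}" "j \<in> {1..k}" "i \<noteq> j"
      have False if ST: "S \<in> sccs_verts" "T \<in> sccs_verts" and v: "v \<in> W S i" "v \<in> W T j" for S T v
      proof -
        have "S = T"
          using same[OF ST] sub ST v ij by blast
        moreover have "W T i \<inter> W T j = {}"
          using W[OF ST(2)] ij unfolding proper_coloring_def disjoint_family_on_def by blast
        ultimately show False
          using v by blast
      qed
      then show "U i \<inter> U j = {}"
        unfolding U_def by blast
    qed
  next
    fix i u v assume i: "i \<in> {1..k}" and u: "u \<in> U i" and v: "v \<in> U i"
    obtain S where S: "S \<in> sccs_verts" "u \<in> W S i"
      using u unfolding U_def by blast
    obtain T where T: "T \<in> sccs_verts" "v \<in> W T i"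
      using v unfolding U_def by blast
    show "\<not> u \<rightarrow> v"
    proof
      assume uv: "u \<rightarrow> v"
      have mem: "u \<in> S" "v \<in> T"
        using sub S T i by blast+
      then have "v \<in> S"
        using scc_closed[OF S(1) _ uv] by blast
      then have "u \<rightarrow>\<^bsub>G \<restriction> S\<^esub> v" "S = T"
        using uv mem same[OF S(1) T(1)] by (simp_all add: adj_induce)
      then show False
        using W[OF S(1)] S(2) T(2) i by (auto simp: proper_coloring_def)
    qed
  qed simp
  then show ?thesis
    using chromatic_number_le by fastforce
qed

lemma graph_eigenvector_induce_closed:
  assumes f: "graph_eigenvector G f \<theta>" and S: "S \<subseteq> verts G" and nz: "\<exists>u\<in>S. f u \<noteq> 0"
    and closed: "\<And>u v. \<lbrakk>u \<in> S; u \<rightarrow> v\<rbrakk> \<Longrightarrow> v \<in> S"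
  shows "graph_eigenvector (G \<restriction> S) f \<theta>"
proof -
  have fin: "finite (verts (G \<restriction> S))"
    using finite_subset[OF S finite_verts] by simp
  have "(\<Sum>v\<in>S. adj (G \<restriction> S) u v * f v) = \<theta> * f u" if u: "u \<in> S" for u
  proof -
    have "(\<Sum>v\<in>S. adj (G \<restriction> S) u v * f v) = (\<Sum>v\<in>verts G. adj G u v * f v)"
      using S u closed[OF u] by (intro sum.mono_neutral_cong_left) (auto simp: adj_induce)
    then show ?thesis
      using f u S unfolding graph_eigenvector_iff[OF finite_verts] by auto
  qed
  then show ?thesis
    using nz unfolding graph_eigenvector_iff[OF fin] by simp
qed

text \<open>For a disconnected graph the definition speaks only of components; this recovers
  equality in Hoffman's bound for the whole graph, where the equality case can be applied.\<close>

lemma hoffman_colorable_tight: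
  assumes hc: "hoffman_colorable G" and col: "proper_coloring G I V"
    and x: "graph_eigenvector G x \<theta>" and pos: "\<forall>u\<in>verts G. 0 < x u"
  shows "lambda_min G < 0" and "\<theta> = - lambda_min G * (real (chromatic_number G) - 1)"
proof -
  have "lambda_min G < 0 \<and> \<theta> = - lambda_min G * (real (chromatic_number G) - 1)"
  proof (cases "Digraph_Component.connected G")
    case True
    then have "arcs G \<noteq> {}" and h: "real (chromatic_number G) = hoffman_bound G"
      using hc by (auto simp: hoffman_colorable_def)
    then have "lambda_min G < 0"
      using lambda_min_neg by blast
    then show ?thesis
      using h lambda_max_positive_eigenvector[OF x pos] by (simp add: hoffman_bound_def field_simps)
  next
    case False
    note * = hc[unfolded hoffman_colorable_def sccs_conv_sccs_verts ball_simps if_not_P[OF False]]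
    have ne: "verts G \<noteq> {}"
      and comp: "\<And>S. S \<in> sccs_verts \<Longrightarrow>
        arcs (G \<restriction> S) \<noteq> {} \<and> real (chromatic_number (G \<restriction> S)) = hoffman_bound (G \<restriction> S)"
      and same: "\<And>S T. \<lbrakk>S \<in> sccs_verts; T \<in> sccs_verts\<rbrakk> \<Longrightarrow>
        chromatic_number (G \<restriction> S) = chromatic_number (G \<restriction> T)"
      using * by blast+
    \<comment> \<open>The component is chosen so that an eigenvector for \<open>lambda_min G\<close>
      does not vanish on it; its restriction shows that the component has this eigenvalue
      too.\<close>
    obtain f where f: "graph_eigenvector G f (lambda_min G)"
      using lambda_min_rayleigh(1)[OF ne] by blast
    then obtain v where v: "v \<in> verts G" "f v \<noteq> 0"
      unfolding graph_eigenvector_iff[OF finite_verts] by blast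
    define S where "S = scc_of v"
    have S: "S \<in> sccs_verts" and vS: "v \<in> S" and sub: "S \<subseteq> verts G"
      using scc_of_in_sccs_verts[OF v(1)] in_scc_of_self[OF v(1)] sccs_verts_subsets
      unfolding S_def by auto
    interpret K: graph "G \<restriction> S"
      using sub by (rule graph_induce)
    have "graph_eigenvector (G \<restriction> S) f (lambda_min G)"
      using v(2) vS scc_closed[OF S] by (intro graph_eigenvector_induce_closed[OF f sub]) auto
    then have "lambda_min (G \<restriction> S) \<le> lambda_min G"
      by (rule K.lambda_min_le)
    moreover have "lambda_min G \<le> lambda_min (G \<restriction> S)"
      using vS by (intro K.lambda_min_greatest_lower rayleigh_induce[OF sub] lambda_min_rayleigh(2)[OF ne]) auto
    ultimately have min: "lambda_min (G \<restriction> S) = lambda_min G"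
      by simp
    have "x v \<noteq> 0"
      using bspec[OF pos v(1)] by simp
    have "graph_eigenvector (G \<restriction> S) x \<theta>"
      using \<open>x v \<noteq> 0\<close> vS scc_closed[OF S] by (intro graph_eigenvector_induce_closed[OF x sub]) auto
    then have max: "lambda_max (G \<restriction> S) = \<theta>"
      using pos sub by (intro K.lambda_max_positive_eigenvector) auto
    have neg: "lambda_min G < 0"
      using K.lambda_min_neg comp[OF S] min by simp
    have tight: "\<theta> = - lambda_min G * (real (chromatic_number (G \<restriction> S)) - 1)"
      using comp[OF S] neg unfolding hoffman_bound_def max min by (simp add: field_simps)
    have "chromatic_number G \<le> chromatic_number (G \<restriction> S)"
      using same S by (intro chromatic_number_le_sccs[OF _ col]) blast
    moreover have "chromatic_number (G \<restriction> S) \<le> chromatic_number G"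
    proof -
      obtain W where W: "proper_coloring G {1..chromatic_number G} W"
        using chromatic_number_attained[OF col] by blast
      have "S \<subseteq> (\<Union>i\<in>{1..chromatic_number G}. W i)"
        using sub W by (simp add: proper_coloring_def)
      from chromatic_number_le[OF proper_coloring_induce[OF W subset_refl this]] show ?thesis
        by simp
    qed
    ultimately show ?thesis
      using tight neg by simp
  qed
  then show "lambda_min G < 0" "\<theta> = - lambda_min G * (real (chromatic_number G) - 1)"
    by auto
qed

text \<open>Every component inherits weight-regularity with the same \<open>\<tau>\<close> and the
  same colors, so all components have equal invariants. The connected case uses the values for
  \<open>G\<close> itself.\<close>

lemma weight_regular_hoffman_colorable:
  assumes wr: "weight_regular G I V x \<tau>" and \<tau>: "0 < \<tau>" and I: "2 \<le> card I"
    and ne: "verts G \<noteq> {}" and pos: "\<forall>u\<in>verts G. 0 < x u"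
    and lower: "\<And>g. - \<tau> * (\<Sum>u\<in>verts G. (g u)\<^sup>2) \<le> bilin (verts G) (adj G) g g"
  shows "hoffman_colorable G"
proof -
  have V: "(\<Union>i\<in>I. V i) = verts G"
    using wr by (auto simp: weight_regular_def proper_coloring_def)
  have K: "lambda_max (G \<restriction> S) = \<tau> * (real (card I) - 1)" "lambda_min (G \<restriction> S) = - \<tau>"
      "chromatic_number (G \<restriction> S) = card I" "arcs (G \<restriction> S) \<noteq> {}"
      "hoffman_bound (G \<restriction> S) = real (card I)"
    if S: "S \<in> sccs_verts" for S
  proof -
    have sub: "S \<subseteq> verts G" and "S \<noteq> {}"
      using S sccs_verts_subsets by (auto simp: sccs_verts_def)
    have wr': "weight_regular (G \<restriction> S) I (\<lambda>i. V i \<inter> S) x \<tau>"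
      using scc_closed[OF S] sub by (intro weight_regular_induce[OF wr]) (auto simp: V)
    have ne': "verts (G \<restriction> S) \<noteq> {}"
      using \<open>S \<noteq> {}\<close> by simp
    have pos': "\<forall>u\<in>verts (G \<restriction> S). 0 < x u"
      using pos sub by auto
    note * = graph.weight_regular_hoffman[OF graph_induce[OF sub] wr' \<tau> I ne' pos' rayleigh_induce[OF sub lower]]
    show "lambda_max (G \<restriction> S) = \<tau> * (real (card I) - 1)" "lambda_min (G \<restriction> S) = - \<tau>"
      "chromatic_number (G \<restriction> S) = card I" "arcs (G \<restriction> S) \<noteq> {}"
      "hoffman_bound (G \<restriction> S) = real (card I)"
      using *(2-6) by simp_all
  qed
  show ?thesis
    unfolding hoffman_colorable_def sccs_conv_sccs_verts ball_simps
    using weight_regular_hoffman(5,6)[OF wr \<tau> I ne pos lower] ne by (simp add: K del: induce_subgraph_arcs)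
qed

end

section \<open>Restriction of a Hoffman coloring to a set of colors\<close>

theorem theorem3p3:
  fixes G H :: "('a, 'b) pre_digraph"
    and V :: "nat \<Rightarrow> 'a set"
    and x :: "'a \<Rightarrow> real"
    and C :: "nat set"
  assumes "graph G"
    and "hoffman_colorable G"
    and "hoffman_coloring G {1..chromatic_number G} V"
    and "positive_eigenvector G x"
    and "C \<subseteq> {1..chromatic_number G}"
    and "2 \<le> card C"
    and "H = G \<restriction> (\<Union>i\<in>C. V i)"
  shows "(hoffman_colorable H \<and> hoffman_coloring H C V) \<and>
    lambda_max H = (real (card C) - 1) / (real (chromatic_number G) - 1) * lambda_max G \<and>
    (positive_eigenvector H (restrict x (verts H)) \<and>
     graph_eigenvector H (restrict x (verts H)) (lambda_max H)) \<and>
    lambda_min H = lambda_min G"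
proof -
  interpret graph G
    by fact
  define S where "S = (\<Union>i\<in>C. V i)"
  define \<tau> where "\<tau> = - lambda_min G"
  have H: "H = G \<restriction> S"
    using assms(7) by (simp add: S_def)
  have col: "proper_coloring G {1..chromatic_number G} V"
    using assms(3) by (simp add: hoffman_coloring_def)
  obtain \<theta> where x: "graph_eigenvector G x \<theta>" and pos: "\<forall>u\<in>verts G. 0 < x u"
    using assms(4) by (auto simp: positive_eigenvector_def)
  have neg: "0 < \<tau>" and tight: "\<theta> = \<tau> * (real (chromatic_number G) - 1)"
    using hoffman_colorable_tight[OF assms(2) col x pos] by (simp_all add: \<tau>_def)
  have max: "lambda_max G = \<theta>"
    using x pos by (rule lambda_max_positive_eigenvector)
  have ne: "verts G \<noteq> {}"
    using x unfolding graph_eigenvector_iff[OF finite_verts] by blast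
  have lower: "- \<tau> * (\<Sum>u\<in>verts G. (g u)\<^sup>2) \<le> bilin (verts G) (adj G) g g" for g
    using lambda_min_rayleigh(2)[OF ne] by (simp add: \<tau>_def)
  have wr: "weight_regular G {1..chromatic_number G} V x \<tau>"
    using tight by (intro hoffman_equality_weight_regular[OF x col lower]) simp
  have sub: "S \<subseteq> verts G"
    using col assms(5) by (auto simp: proper_coloring_def S_def)
  have "V i \<inter> S = V i" if "i \<in> C" for i
    using that by (auto simp: S_def)
  moreover have wrS: "weight_regular H C (\<lambda>i. V i \<inter> S) x \<tau>"
    unfolding H using assms(5) by (intro weight_regular_induce[OF wr]) (auto simp: S_def)
  ultimately have wrH: "weight_regular H C V x \<tau>"
    by (simp add: weight_regular_def proper_coloring_def disjoint_family_on_def)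
  interpret H: graph H
    unfolding H using sub by (rule graph_induce)
  obtain i where i: "i \<in> C"
    using assms(6) by (cases "C = {}") auto
  obtain u where u: "u \<in> verts G"
    using ne by blast
  \<comment> \<open>A proper coloring may have empty classes. Here an empty \<open>V i\<close> would
    force the class sum \<open>\<tau> * x u\<close>, which is positive, to be zero.\<close>
  have neH: "verts H \<noteq> {}"
  proof
    assume "verts H = {}"
    then have "V i = {}"
      using i by (auto simp: H S_def)
    then have "(\<Sum>v\<in>V i. adj G u v * x v) = 0" "u \<notin> V i"
      by auto
    moreover have "(\<Sum>v\<in>V i. adj G u v * x v) = (if u \<in> V i then 0 else \<tau> * x u)"
      using i assms(5) by (intro weight_regular_class_sum[OF wr _ u]) auto
    ultimately show False
      using neg bspec[OF pos u] by simp
  qed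
  have posH: "\<forall>u\<in>verts H. 0 < x u"
    using pos sub by (auto simp: H)
  have lowerH: "- \<tau> * (\<Sum>u\<in>verts H. (g u)\<^sup>2) \<le> bilin (verts H) (adj H) g g" for g
    unfolding H using sub lower by (rule rayleigh_induce)
  note hoff = H.weight_regular_hoffman[OF wrH neg assms(6) neH posH lowerH]
  have colorable: "hoffman_colorable H"
    using H.weight_regular_hoffman_colorable[OF wrH neg assms(6) neH posH lowerH] .
  have "hoffman_coloring H C V"
    using colorable hoff(4) wrH by (simp add: hoffman_coloring_def weight_regular_def)
  moreover have "lambda_max H = (real (card C) - 1) / (real (chromatic_number G) - 1) * lambda_max G"
  proof -
    \<comment> \<open>With \<open>2 \<le> card C\<close> this makes the denominator
      \<open>chromatic_number G - 1\<close> nonzero, so it cancels.\<close>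
    have "card C \<le> chromatic_number G"
      using card_mono[OF _ assms(5)] by simp
    then show ?thesis
      using assms(6) hoff(2) max tight by simp
  qed
  moreover have "graph_eigenvector H (restrict x (verts H)) (lambda_max H)"
    using hoff(1) unfolding graph_eigenvector_iff[OF H.finite_verts] by (simp cong: sum.cong)
  moreover from this have "positive_eigenvector H (restrict x (verts H))"
    using posH by (auto simp: positive_eigenvector_def)
  ultimately show ?thesis
    using colorable hoff(3) by (simp add: \<tau>_def)
qed

end
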